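(* Let $\varepsilon>0$, $T>0$, let $N_T$ and $N$ be two positive integers, and let $(\rho^n,u^n,\phi^n)_{n=0,\dots,N_T}\subset X(\mathcal T)\times X(\mathcal T^\star)\times X(\mathcal T)$ be a solution to the numerical scheme (defined in the context) such that $\rho^n>0$ for all $n\in\{0,\dots,N_T\}$. Assume that $\phi^0$ satisfies the discrete Poisson equation initially, i.e. $\varepsilon^2(\Delta\phi^0)_i+e^{-\phi^0_i}=\rho^0_i$ for all $i\in\{0,\dots,N\}$. Let $(\bar u,\bar\phi)\in X(\mathcal T^\star)\times X(\mathcal T)$ be a constant state (i.e. $\bar u,\bar\phi$ are real constants). Then: (a) If $\bar u=0$, then for all $n\in\{0,\dots,N_T\}$, $\ \mathcal E(\rho^n,u^n,\phi^n\,|\,0,\bar\phi)\le\mathcal E(\rho^0,u^0,\phi^0\,|\,0,\bar\phi)$. (b) Suppose $\bar u\ne0$ and $|\bar u|\le\frac{g(0)}{\mathrm{Lip}(g)}$. Suppose there is a constant $K\ge0$, bounded uniformly as $\varepsilon\to0$ and as $\Delta x\to0$ (i.e. $K\le K_0$ with $K_0$ independent of $\varepsilon$ and $\Delta x$), such that $\|\rho^n\|_{L^\infty(\mathbb T)}\le K$ for all $n\in\{0,\dots,N_T\}$. Suppose moreover $\Delta x=\mathcal O(\varepsilon)$ as $\varepsilon\to0$ (i.e. $\Delta x\le C_0\,\varepsilon$ with $C_0$ independent of $\varepsilon$). If the CFL condition $$|\bar u|\frac{\Delta t}{\Delta x}\Big(8\,\mathrm{Lip}(g)+4+\frac{2\Delta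 x^2}{\varepsilon^2}K\Big)<1$$ holds, then for all $n\in\{0,\dots,N_T\}$, $$\mathcal E(\rho^n,u^n,\phi^n\,|\,\bar u,\bar\phi)\le a^n\,\mathcal E(\rho^0,u^0,\phi^0\,|\,\bar u,\bar\phi),\qquad a=\frac{1}{1-|\bar u|\frac{\Delta t}{\Delta x}\Big(8\,\mathrm{Lip}(g)+4+\frac{2\Delta x^2}{\varepsilon^2}K\Big)},$$ where $a^n$ is the $n$-th power of $a$.
   Context: **Grid and spaces.** $\mathbb T=\mathbb R/\mathbb Z$, $\Delta x=\frac1{N+1}$, $x_i=i\Delta x$, $x_{i+\frac12}=x_i+\frac{\Delta x}2$, all integer indices $i$ being understood modulo $N+1$ (representatives in $\{0,\dots,N\}$). Cells: $C_i=[x_i-\frac{\Delta x}2,x_i+\frac{\Delta x}2)$ and $C_{i+\frac12}=[x_{i+\frac12}-\frac{\Delta x}2,x_{i+\frac12}+\frac{\Delta x}2)$. $X(\mathcal T)$ (resp. $X(\mathcal T^\star)$) is the space of real functions on $\mathbb T$ constant on each $C_i$ with value $v_i$ (resp. on each $C_{i+\frac12}$ with value $v_{i+\frac12}$), $i\in\{0,\dots,N\}$. For $\varphi\in X(\mathcal T)$: $\delta(\varphi)_{i+\frac12}=\frac{\varphi_{i+1}-\varphi_i}{\Delta x}$, $(\Delta\varphi)_i=\frac{\varphi_{i+1}-2\varphi_i+\varphi_{i-1}}{\Delta x^2}$. **The function $g$.** $g:\mathbb R\to\mathbb R$ is a fixed Lipschitz function with (best) Lipschitz constant $\mathrm{Lip}(g)$,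 differentiable at $0$, with $g(u)\ge\max(u,0)$ for all $u\in\mathbb R$. Set $G(s,t,u)=s\,g(u)-t\,(g(u)-u)$ for $(s,t,u)\in\mathbb R^3$. **Scheme.** $\Delta t=T/N_T$. A solution is a family $(\rho^n,u^n,\phi^n)_{n=0,\dots,N_T}\subset X(\mathcal T)\times X(\mathcal T^\star)\times X(\mathcal T)$ such that for all $n\in\{0,\dots,N_T-1\}$ and $i\in\{0,\dots,N\}$: $$\frac{\rho_i^{n+1}-\rho_i^n}{\Delta t}+\frac{\mathcal F^{n+1}_{i+\frac12}-\mathcal F^{n+1}_{i-\frac12}}{\Delta x}=0,$$ $$\frac{\rho^{n+1}_{i+\frac12}u^{n+1}_{i+\frac12}-\rho^n_{i+\frac12}u^n_{i+\frac12}}{\Delta t}+\frac{\mathcal F^{n+1}_{i+1}u^{n+1}_{i+1}-\mathcal F^{n+1}_iu^{n+1}_i}{\Delta x}=\tilde\rho^{n+1}_{i+\frac12}\,\delta(\phi^{n+1})_{i+\frac12},$$ $$\varepsilon^2(\Delta\phi^{n+1})_i+e^{-\phi^{n+1}_i}=\rho^{n+1}_i,$$ with $\mathcal F^{n+1}_{i+\frac12}=G(\rho^{n+1}_i,\rho^{n+1}_{i+1},u^{n+1}_{i+\frac12})$, $\mathcal F^{n+1}_i=\frac12(\mathcal F^{n+1}_{i+\frac12}+\mathcal F^{n+1}_{i-\frac12})$, $\rho^n_{i+\frac12}=\frac12(\rho^n_i+\rho^n_{i+1})$ for all $n$; $u^{n+1}_i=u^{n+1}_{i-\frac12}$ if $\mathcal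 F^{n+1}_i\ge0$ and $u^{n+1}_i=u^{n+1}_{i+\frac12}$ if $\mathcal F^{n+1}_i<0$; and $$\tilde\rho^{n+1}_{i+\frac12}=\begin{cases}\dfrac{G(\rho^{n+1}_i,\rho^{n+1}_{i+1},u^{n+1}_{i+\frac12})-G(\rho^{n+1}_i,\rho^{n+1}_{i+1},0)}{u^{n+1}_{i+\frac12}}&\text{if }u^{n+1}_{i+\frac12}\ne0,\\ \rho^{n+1}_{i+1}-(\rho^{n+1}_{i+1}-\rho^{n+1}_i)g'(0)&\text{if }u^{n+1}_{i+\frac12}=0.\end{cases}$$ **Modulated energy.** With $\tilde h(\psi)=\psi\log\psi-\psi$ for $\psi>0$ and $\rho_{i+\frac12}=\frac12(\rho_i+\rho_{i+1})$, $$\mathcal E(\rho,u,\phi\,|\,\bar u,\bar\phi)=\sum_{i=0}^N\rho_{i+\frac12}\frac{(u_{i+\frac12}-\bar u)^2}2\Delta x+\sum_{i=0}^N\frac{\varepsilon^2}2\Big|\frac{\phi_{i+1}-\phi_i}{\Delta x}\Big|^2\Delta x+\sum_{i=0}^N\Big[\tilde h(e^{-\phi_i})-\Big(\tilde h(e^{-\bar\phi})+\tilde h'(e^{-\bar\phi})(e^{-\phi_i}-e^{-\bar\phi})\Big)\Big]\Delta x.$$ *)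

theory Defs
  imports "HOL-Analysis.Analysis" "HOL-Probability.Essential_Supremum"
begin

definition mesh :: "nat \<Rightarrow> real" where
  "mesh N = 1 / (real N + 1)"

definition node :: "nat \<Rightarrow> int \<Rightarrow> real" where
  "node N i = of_int i * mesh N"

text \<open>In all functions below an argument \<open>i\<close> attached to a staggered quantity stands for the
  half-integer index \<open>i + 1/2\<close>; thus \<open>node_half N i\<close> is $x_{i+1/2}$ and
  \<open>node_half N (i - 1)\<close> is $x_{i-1/2}$.\<close>

definition node_half :: "nat \<Rightarrow> int \<Rightarrow> real" where
  "node_half N i = node N i + mesh N / 2"

definition cell :: "nat \<Rightarrow> int \<Rightarrow> real set" where
  "cell N i = {node N i - mesh N / 2 ..< node N i + mesh N / 2}"

definition cell_half :: "nat \<Rightarrow> int \<Rightarrow> real set" where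
  "cell_half N i = {node_half N i - mesh N / 2 ..< node_half N i + mesh N / 2}"

text \<open>Functions on the torus $\mathbb{R}/\mathbb{Z}$ are functions on the reals with period 1.
  Since $x_{i+N+1} = x_i + 1$, periodicity makes the indices of the values
  $v_i$ and $v_{i+1/2}$ below integers modulo $N+1$.\<close>

definition torus_fun :: "(real \<Rightarrow> real) \<Rightarrow> bool" where
  "torus_fun v \<longleftrightarrow> (\<forall>x. v (x + 1) = v x)"

definition X_primal :: "nat \<Rightarrow> (real \<Rightarrow> real) set" where
  "X_primal N = {v. torus_fun v \<and> (\<forall>i\<in>{0..int N}. v constant_on cell N i)}"

definition X_dual :: "nat \<Rightarrow> (real \<Rightarrow> real) set" where
  "X_dual N = {v. torus_fun v \<and> (\<forall>i\<in>{0..int N}. v constant_on cell_half N i)}"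

definition val :: "nat \<Rightarrow> (real \<Rightarrow> real) \<Rightarrow> int \<Rightarrow> real" where
  "val N v i = v (node N i)"

definition val_half :: "nat \<Rightarrow> (real \<Rightarrow> real) \<Rightarrow> int \<Rightarrow> real" where
  "val_half N v i = v (node_half N i)"

definition Linf_norm :: "(real \<Rightarrow> real) \<Rightarrow> ereal" where
  "Linf_norm v = esssup (lebesgue_on {0..<1}) (\<lambda>x. ereal \<bar>v x\<bar>)"

definition dgrad :: "nat \<Rightarrow> (real \<Rightarrow> real) \<Rightarrow> int \<Rightarrow> real" where
  "dgrad N \<phi> i = (val N \<phi> (i + 1) - val N \<phi> i) / mesh N"

definition dlaplace :: "nat \<Rightarrow> (real \<Rightarrow> real) \<Rightarrow> int \<Rightarrow> real" where
  "dlaplace N \<phi> i = (val N \<phi> (i + 1) - 2 * val N \<phi> i + val N \<phi> (i - 1)) / (mesh N)\<^sup>2"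

definition mean_half :: "nat \<Rightarrow> (real \<Rightarrow> real) \<Rightarrow> int \<Rightarrow> real" where
  "mean_half N \<rho> i = (val N \<rho> i + val N \<rho> (i + 1)) / 2"

definition Lip :: "(real \<Rightarrow> real) \<Rightarrow> real" where
  "Lip g = Inf {L. L-lipschitz_on UNIV g}"

definition G :: "(real \<Rightarrow> real) \<Rightarrow> real \<Rightarrow> real \<Rightarrow> real \<Rightarrow> real" where
  "G g s t u = s * g u - t * (g u - u)"

definition flux_half :: "(real \<Rightarrow> real) \<Rightarrow> nat \<Rightarrow> (real \<Rightarrow> real) \<Rightarrow> (real \<Rightarrow> real) \<Rightarrow> int \<Rightarrow> real" where
  "flux_half g N \<rho> u i = G g (val N \<rho> i) (val N \<rho> (i + 1)) (val_half N u i)"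

definition flux :: "(real \<Rightarrow> real) \<Rightarrow> nat \<Rightarrow> (real \<Rightarrow> real) \<Rightarrow> (real \<Rightarrow> real) \<Rightarrow> int \<Rightarrow> real" where
  "flux g N \<rho> u i = (flux_half g N \<rho> u i + flux_half g N \<rho> u (i - 1)) / 2"

definition upwind :: "(real \<Rightarrow> real) \<Rightarrow> nat \<Rightarrow> (real \<Rightarrow> real) \<Rightarrow> (real \<Rightarrow> real) \<Rightarrow> int \<Rightarrow> real" where
  "upwind g N \<rho> u i =
     (if flux g N \<rho> u i \<ge> 0 then val_half N u (i - 1) else val_half N u i)"

definition rho_tilde :: "(real \<Rightarrow> real) \<Rightarrow> nat \<Rightarrow> (real \<Rightarrow> real) \<Rightarrow> (real \<Rightarrow> real) \<Rightarrow> int \<Rightarrow> real" where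
  "rho_tilde g N \<rho> u i =
     (if val_half N u i \<noteq> 0
      then (G g (val N \<rho> i) (val N \<rho> (i + 1)) (val_half N u i)
            - G g (val N \<rho> i) (val N \<rho> (i + 1)) 0) / val_half N u i
      else val N \<rho> (i + 1) - (val N \<rho> (i + 1) - val N \<rho> i) * deriv g 0)"

definition discrete_poisson :: "real \<Rightarrow> nat \<Rightarrow> (real \<Rightarrow> real) \<Rightarrow> (real \<Rightarrow> real) \<Rightarrow> bool" where
  "discrete_poisson \<epsilon> N \<rho> \<phi> \<longleftrightarrow>
     (\<forall>i\<in>{0..int N}. \<epsilon>\<^sup>2 * dlaplace N \<phi> i + exp (- val N \<phi> i) = val N \<rho> i)"

definition scheme_solution ::
  "(real \<Rightarrow> real) \<Rightarrow> real \<Rightarrow> real \<Rightarrow> nat \<Rightarrow> nat \<Rightarrow>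
   (nat \<Rightarrow> real \<Rightarrow> real) \<Rightarrow> (nat \<Rightarrow> real \<Rightarrow> real) \<Rightarrow> (nat \<Rightarrow> real \<Rightarrow> real) \<Rightarrow> bool" where
  "scheme_solution g \<epsilon> T N\<^sub>T N \<rho> u \<phi> \<longleftrightarrow>
     (\<forall>n\<in>{0..N\<^sub>T}. \<rho> n \<in> X_primal N \<and> u n \<in> X_dual N \<and> \<phi> n \<in> X_primal N) \<and>
     (\<forall>n\<in>{0..<N\<^sub>T}.
        (\<forall>i\<in>{0..int N}.
           (val N (\<rho> (n + 1)) i - val N (\<rho> n) i) / (T / real N\<^sub>T)
           + (flux_half g N (\<rho> (n + 1)) (u (n + 1)) i
              - flux_half g N (\<rho> (n + 1)) (u (n + 1)) (i - 1)) / mesh N = 0) \<and>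
        (\<forall>i\<in>{0..int N}.
           (mean_half N (\<rho> (n + 1)) i * val_half N (u (n + 1)) i
            - mean_half N (\<rho> n) i * val_half N (u n) i) / (T / real N\<^sub>T)
           + (flux g N (\<rho> (n + 1)) (u (n + 1)) (i + 1) * upwind g N (\<rho> (n + 1)) (u (n + 1)) (i + 1)
              - flux g N (\<rho> (n + 1)) (u (n + 1)) i * upwind g N (\<rho> (n + 1)) (u (n + 1)) i) / mesh N
           = rho_tilde g N (\<rho> (n + 1)) (u (n + 1)) i * dgrad N (\<phi> (n + 1)) i) \<and>
        discrete_poisson \<epsilon> N (\<rho> (n + 1)) (\<phi> (n + 1)))"

definition h_tilde :: "real \<Rightarrow> real" where
  "h_tilde \<psi> = \<psi> * ln \<psi> - \<psi>"

definition modulated_energy ::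
  "real \<Rightarrow> nat \<Rightarrow> (real \<Rightarrow> real) \<Rightarrow> (real \<Rightarrow> real) \<Rightarrow> (real \<Rightarrow> real) \<Rightarrow> real \<Rightarrow> real \<Rightarrow> real" where
  "modulated_energy \<epsilon> N \<rho> u \<phi> ub \<phi>b =
     (\<Sum>i\<in>{0..int N}. mean_half N \<rho> i * ((val_half N u i - ub)\<^sup>2 / 2) * mesh N)
     + (\<Sum>i\<in>{0..int N}. \<epsilon>\<^sup>2 / 2 * \<bar>(val N \<phi> (i + 1) - val N \<phi> i) / mesh N\<bar>\<^sup>2 * mesh N)
     + (\<Sum>i\<in>{0..int N}.
          (h_tilde (exp (- val N \<phi> i))
           - (h_tilde (exp (- \<phi>b))
              + deriv h_tilde (exp (- \<phi>b)) * (exp (- val N \<phi> i) - exp (- \<phi>b)))) * mesh N)"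

definition cfl_number ::
  "(real \<Rightarrow> real) \<Rightarrow> real \<Rightarrow> real \<Rightarrow> nat \<Rightarrow> nat \<Rightarrow> real \<Rightarrow> real \<Rightarrow> real" where
  "cfl_number g \<epsilon> T N\<^sub>T N K ub =
     \<bar>ub\<bar> * ((T / real N\<^sub>T) / mesh N) * (8 * Lip g + 4 + 2 * (mesh N)\<^sup>2 / \<epsilon>\<^sup>2 * K)"

end

theory Submission
  imports Defs
begin

text \<open>
  Testing the momentum equation with $w = u - \bar u$ and using the upwind choice, the kinetic energy
  grows in one step by at most $\Delta t \sum \tilde\rho\, \delta\phi\, (u - \bar u) \Delta x$. By
  construction $\tilde\rho u = \mathcal F + g(0) (\rho_{i+1} - \rho_i)$. Summation by parts, the mass
  and Poisson equations and convexity show that the $\mathcal F$ part is at most the loss of potential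
  energy, while the $g(0)$ part is at most $- \Delta t\, g(0) \sum Q_i$, where
  $Q_i = (\phi_{i+1} - \phi_i)(e^{-\phi_i} - e^{-\phi_{i+1}}) \ge 0$.

  There remains the drift $- \bar u \Delta t \sum \tilde\rho\, \delta\phi\, \Delta x$. Here
  $\tilde\rho = \rho_{i+1} - (\rho_{i+1} - \rho_i) \theta$ with $|\theta| \le \mathrm{Lip}(g)$.
  Inserting the Poisson equation, the $\varepsilon^2 \Delta\phi$ part is at most
  $|\bar u| \frac{\Delta t}{\Delta x} (8\, \mathrm{Lip}(g) + 4)$ times the field energy. After adding
  a telescoping term the $e^{-\phi}$ part is a quadrature error, bounded by
  $|\bar u| \Delta t\, (\mathrm{Lip}(g) + 1) \sum Q_i$: the dissipation absorbs the
  $\mathrm{Lip}(g)$ share because $|\bar u|\, \mathrm{Lip}(g) \le g(0)$, and the rest is controlled by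
  the field energy through $Q_i \le K (\phi_{i+1} - \phi_i)^2$, which follows from the discrete maximum
  principle $e^{-\phi} \le K$.
\<close>

section \<open>Periodic sequences and summation over one period\<close>

text \<open>The codomain is left arbitrary so that boolean-valued sequences are covered: an equation
  or inequality depending on an index is then itself a periodic object.\<close>

definition periodic :: "nat \<Rightarrow> (int \<Rightarrow> 'a) \<Rightarrow> bool" where
  "periodic N f \<longleftrightarrow> (\<forall>i. f (i + (int N + 1)) = f i)"

lemma periodic_shift: "periodic N f \<Longrightarrow> periodic N (\<lambda>i. f (i + c))"
  unfolding periodic_def by (metis add.assoc add.commute)

lemma periodic_shift_minus: "periodic N f \<Longrightarrow> periodic N (\<lambda>i. f (i - c))"
  using periodic_shift[of N f "- c"] by simp

lemma periodic_const: "periodic N (\<lambda>i. c)"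
  by (simp add: periodic_def)

lemma periodic_comp: "periodic N f \<Longrightarrow> periodic N (\<lambda>i. F (f i))"
  by (simp add: periodic_def)

lemma periodic_comp2: "periodic N f \<Longrightarrow> periodic N f' \<Longrightarrow> periodic N (\<lambda>i. F (f i) (f' i))"
  by (simp add: periodic_def)

lemma periodic_if:
  "periodic N b \<Longrightarrow> periodic N f \<Longrightarrow> periodic N f' \<Longrightarrow> periodic N (\<lambda>i. if b i then f i else f' i)"
  by (simp add: periodic_def)

text \<open>The operations are fixed here because the general rules, with a variable
  \<open>F\<close>, would unify with any goal when used by \<open>intro\<close>.\<close>

lemmas periodic_arith =
  periodic_const
  periodic_comp2[where F = "(+)"] periodic_comp2[where F = "(-)"] periodic_comp2[where F = "(*)"]
  periodic_comp2[where F = "(/)"] periodic_comp2[where F = "(^)"] periodic_comp2[where F = "(=)"]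
  periodic_comp2[where F = "(\<le>)"] periodic_comp[where F = uminus]
  periodic_comp[where F = exp]

lemma periodic_mult_period:
  assumes "periodic N f"
  shows "f (i + int k * (int N + 1)) = f i"
proof (induction k)
  case (Suc k)
  have "f (i + int (Suc k) * (int N + 1)) = f ((i + int k * (int N + 1)) + (int N + 1))"
    by (simp add: algebra_simps)
  then show ?case
    using assms Suc by (simp add: periodic_def)
qed simp

lemma periodic_mod:
  assumes "periodic N f"
  shows "f (i mod (int N + 1)) = f i"
proof -
  let ?m = "int N + 1" and ?q = "i div (int N + 1)"
  have i: "i mod ?m = i + (- ?q) * ?m"
    by (simp add: minus_div_mult_eq_mod [symmetric])
  show ?thesis
  proof (cases "?q \<ge> 0")
    case True
    have "f (i mod ?m + int (nat ?q) * ?m) = f (i mod ?m)"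
      by (rule periodic_mult_period[OF assms])
    moreover have "i mod ?m + int (nat ?q) * ?m = i"
      using True i by simp
    ultimately show ?thesis by simp
  next
    case False
    then have "i mod ?m = i + int (nat (- ?q)) * ?m"
      using i by simp
    then show ?thesis
      using periodic_mult_period[OF assms, of i "nat (- ?q)"] by (simp only:)
  qed
qed

text \<open>The scheme is imposed only on the representatives in \<open>{0..int N}\<close>;
  summation by parts and the neighbours \<open>i - 1\<close>, \<open>i + 1\<close> need it at every
  integer.\<close>

lemma periodic_ball_imp_all:
  assumes "periodic N P" "\<forall>i\<in>{0..int N}. P i"
  shows "P i"
proof -
  have "i mod (int N + 1) \<in> {0..int N}"
    using pos_mod_bound[of "int N + 1" i] pos_mod_sign[of "int N + 1" i] by auto
  then show ?thesis
    using assms periodic_mod by metis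
qed

lemma sum_periodic_shift:
  fixes f :: "int \<Rightarrow> real"
  assumes "periodic N f"
  shows "(\<Sum>i\<in>{0..int N}. f (i + 1)) = (\<Sum>i\<in>{0..int N}. f i)"
proof -
  have "(\<Sum>i\<in>{0..int N}. f (i + 1)) = (\<Sum>i\<in>{1..int N + 1}. f i)"
    by (rule sum.reindex_bij_witness[where i = "\<lambda>i. i - 1" and j = "\<lambda>i. i + 1"]) auto
  also have "{1..int N + 1} = insert (int N + 1) {1..int N}"
    by auto
  also have "sum f \<dots> = f 0 + sum f {1..int N}"
    using assms[unfolded periodic_def, rule_format, of 0] by simp
  also have "\<dots> = sum f (insert 0 {1..int N})"
    by simp
  also have "insert 0 {1..int N} = {0..int N}"
    by auto
  finally show ?thesis .
qed

lemma sum_periodic_shift_minus: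
  fixes f :: "int \<Rightarrow> real"
  assumes "periodic N f"
  shows "(\<Sum>i\<in>{0..int N}. f (i - 1)) = (\<Sum>i\<in>{0..int N}. f i)"
  using sum_periodic_shift[OF periodic_shift_minus[OF assms, of 1]] by simp

lemma sum_by_parts_periodic:
  fixes a b :: "int \<Rightarrow> real"
  assumes "periodic N a" "periodic N b"
  shows "(\<Sum>i\<in>{0..int N}. a i * (b (i + 1) - b i)) = - (\<Sum>i\<in>{0..int N}. b i * (a i - a (i - 1)))"
proof -
  have "periodic N (\<lambda>i. a (i - 1) * b i)"
    by (intro periodic_arith periodic_shift_minus assms)
  from sum_periodic_shift[OF this]
  have "(\<Sum>i\<in>{0..int N}. a i * b (i + 1)) = (\<Sum>i\<in>{0..int N}. a (i - 1) * b i)"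
    by simp
  then show ?thesis
    by (simp add: algebra_simps sum_subtractf)
qed

section \<open>Grid values and the sup norm\<close>

lemma periodic_val: "torus_fun v \<Longrightarrow> periodic N (val N v)"
  and periodic_val_half: "torus_fun v \<Longrightarrow> periodic N (val_half N v)"
proof -
  have node: "node N (i + (int N + 1)) = node N i + 1" for i
    by (simp add: node_def mesh_def field_simps)
  show "torus_fun v \<Longrightarrow> periodic N (val N v)"
    by (simp add: periodic_def val_def node torus_fun_def)
  assume v: "torus_fun v"
  show "periodic N (val_half N v)"
    unfolding periodic_def
  proof
    fix i
    have "node_half N (i + (int N + 1)) = node_half N i + 1"
      by (simp add: node_half_def node)
    then show "val_half N v (i + (int N + 1)) = val_half N v i"
      using v by (simp add: val_half_def torus_fun_def)
  qed
qed

lemma mesh_pos: "mesh N > 0"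
  by (simp add: mesh_def add_nonneg_pos)

text \<open>An essential supremum ignores null sets, but \<open>v\<close> keeps its nodal value on
  an interval of positive length, so the value at the node is controlled as well.\<close>

lemma val_le_Linf_norm:
  assumes v: "v \<in> X_primal N" and i: "i \<in> {0..int N}" and K: "Linf_norm v \<le> ereal K"
  shows "val N v i \<le> K"
proof (rule ccontr)
  assume neg: "\<not> val N v i \<le> K"
  \<comment> \<open>Only the right half of the cell is taken: for \<open>i = 0\<close> the left half
    leaves the fundamental domain \<open>{0..<1}\<close>.\<close>
  define I where "I = {node N i ..< node N i + mesh N / 2}"
  have "node N i + mesh N / 2 \<le> real N * mesh N + mesh N / 2"
    using i mesh_pos[of N] by (simp add: node_def)
  also have "\<dots> \<le> (real N + 1) * mesh N"
    using mesh_pos[of N] by (simp add: algebra_simps)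
  also have "\<dots> = 1"
    by (simp add: mesh_def)
  finally have "node N i + mesh N / 2 \<le> 1" .
  moreover have "0 \<le> node N i"
    using i mesh_pos[of N] by (simp add: node_def)
  ultimately have I01: "I \<subseteq> {0..<1}"
    by (auto simp: I_def)
  have vI: "v x = val N v i" if "x \<in> I" for x
  proof -
    have "x \<in> cell N i" "node N i \<in> cell N i"
      using that mesh_pos[of N] by (auto simp: I_def cell_def)
    moreover obtain y where "\<forall>x\<in>cell N i. v x = y"
      using v i unfolding X_primal_def constant_on_def by blast
    ultimately show ?thesis
      by (simp add: val_def)
  qed
  have "AE x in lebesgue_on {0..<1}. ereal \<bar>v x\<bar> \<le> Linf_norm v"
    unfolding Linf_norm_def by (rule esssup_AE)
  then have "AE x in lebesgue_on {0..<1}. \<bar>v x\<bar> \<le> K"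
    by (rule AE_mp) (use K in \<open>auto intro!: AE_I2 dest: order_trans\<close>)
  then have "AE x in lebesgue_on {0..<1}. x \<notin> I"
    by (rule AE_mp) (use neg vI in \<open>auto intro!: AE_I2\<close>)
  moreover have "I \<in> sets (lebesgue_on {0..<1})"
    using I01 by (auto simp: I_def sets_restrict_space_iff)
  ultimately have "emeasure (lebesgue_on {0..<1}) I = 0"
    using I01 by (subst (asm) AE_iff_measurable[where N = I]) (auto simp: space_restrict_space)
  then have "emeasure lebesgue I = 0"
    using I01 by (subst (asm) emeasure_restrict_space) auto
  then show False
    using mesh_pos[of N] by (simp add: I_def)
qed


section \<open>Convexity inequalities for the exponential\<close>

text \<open>The term of the modulated energy coming from the electron density \<open>exp (- a)\<close>, relative
  to the constant state \<open>exp (- b)\<close>.\<close>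

definition rel_entropy :: "real \<Rightarrow> real \<Rightarrow> real" where
  "rel_entropy a b = exp (- a) * (b - a) - exp (- a) + exp (- b)"

text \<open>Convexity: \<open>rel_entropy a b\<close> is the gap at \<open>b\<close> between the
  function \<open>exp (- x)\<close> and its tangent line at \<open>a\<close>.\<close>

lemma rel_entropy_nonneg: "rel_entropy a b \<ge> 0"
proof -
  have "exp (- a) * (1 + (a - b)) \<le> exp (- a) * exp (a - b)"
    by (intro mult_left_mono exp_ge_add_one_self) simp
  also have "\<dots> = exp (- b)"
    by (simp flip: exp_add)
  finally show ?thesis
    by (simp add: rel_entropy_def algebra_simps)
qed

text \<open>Three-point identity: the right side exceeds the left side by exactly
  \<open>rel_entropy q p\<close>.\<close>

lemma exp_increment_le_rel_entropy_diff:
  "p * (exp (- p) - exp (- q))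
     \<le> rel_entropy q b - rel_entropy p b + b * (exp (- p) - exp (- q))"
  using rel_entropy_nonneg[of q p] by (simp add: rel_entropy_def algebra_simps)

lemma exp_jump_nonneg: "0 \<le> (b - a) * (exp (- a) - exp (- b :: real))"
  by (cases "a \<le> b") (simp_all add: mult_nonpos_nonpos)

text \<open>The tangent line at the smaller argument, where the density is larger, bounds the jump
  of the exponential linearly.\<close>

lemma exp_jump_le:
  fixes a b K :: real
  assumes "exp (- a) \<le> K" "exp (- b) \<le> K"
  shows "(b - a) * (exp (- a) - exp (- b)) \<le> K * (b - a)\<^sup>2"
proof (cases "a \<le> b")
  case True
  have "exp (- a) - exp (- b) \<le> exp (- a) * (b - a)"
    using rel_entropy_nonneg[of a b] by (simp add: rel_entropy_def)
  also have "\<dots> \<le> K * (b - a)"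
    using True assms by (intro mult_right_mono) auto
  finally have "(b - a) * (exp (- a) - exp (- b)) \<le> (b - a) * (K * (b - a))"
    using True by (intro mult_left_mono) auto
  then show ?thesis
    by (simp add: power2_eq_square algebra_simps)
next
  case False
  have "exp (- b) - exp (- a) \<le> exp (- b) * (a - b)"
    using rel_entropy_nonneg[of b a] by (simp add: rel_entropy_def)
  also have "\<dots> \<le> K * (a - b)"
    using False assms by (intro mult_right_mono) auto
  finally have "(a - b) * (exp (- b) - exp (- a)) \<le> (a - b) * (K * (a - b))"
    using False by (intro mult_left_mono) auto
  then show ?thesis
    by (simp add: power2_eq_square algebra_simps)
qed

text \<open>The correction \<open>exp (- b) - exp (- a)\<close> turns the left-hand side into a quadrature error;
  it sums to zero over a period.\<close>

lemma quadrature_error_le: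
  fixes a b \<theta> L :: real
  assumes "\<bar>\<theta>\<bar> \<le> L"
  shows "\<bar>(exp (- b) - (exp (- b) - exp (- a)) * \<theta>) * (b - a) + (exp (- b) - exp (- a))\<bar>
    \<le> (L + 1) * ((b - a) * (exp (- a) - exp (- b)))"
proof -
  define Q where "Q = (b - a) * (exp (- a) - exp (- b))"
  have Q: "Q \<ge> 0"
    by (simp add: Q_def exp_jump_nonneg)
  have "\<bar>\<theta> * Q\<bar> \<le> L * Q"
    using assms Q by (simp add: abs_mult mult_right_mono)
  moreover have "(exp (- b) - (exp (- b) - exp (- a)) * \<theta>) * (b - a) + (exp (- b) - exp (- a))
      = \<theta> * Q - rel_entropy b a"
    by (simp add: Q_def rel_entropy_def algebra_simps)
  \<comment> \<open>\<open>Q\<close> is the symmetrised relative entropy, so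
    \<open>rel_entropy b a\<close> lies between 0 and \<open>Q\<close>; this accounts for the extra
    1 in \<open>L + 1\<close>.\<close>
  moreover have "Q = rel_entropy a b + rel_entropy b a"
    by (simp add: Q_def rel_entropy_def algebra_simps)
  ultimately show ?thesis
    using rel_entropy_nonneg[of a b] rel_entropy_nonneg[of b a]
    unfolding Q_def[symmetric] by (simp add: distrib_right abs_le_iff)
qed

text \<open>For \<open>a\<close>, \<open>b\<close>, \<open>c\<close> three consecutive potential
  differences, this is the electrostatic share of the drift. Each product is split by Young's
  inequality; summed over a period the weights become \<open>2\<close> and
  \<open>4 * L\<close>.\<close>

lemma third_difference_product_le:
  fixes a b c \<theta> L :: real
  assumes "\<bar>\<theta>\<bar> \<le> L"
  shows "\<bar>((c - b) - ((c - b) - (b - a)) * \<theta>) * b\<bar>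
    \<le> (c\<^sup>2 + 3 * b\<^sup>2) / 2 + L * ((a\<^sup>2 + c\<^sup>2) / 2 + 3 * b\<^sup>2)"
proof -
  have *: "\<bar>x * y\<bar> \<le> (x\<^sup>2 + y\<^sup>2) / 2" for x y :: real
    using zero_le_power2[of "x - y"] zero_le_power2[of "x + y"]
    by (auto simp: abs_le_iff power2_sum power2_diff)
  have cb: "\<bar>c * b\<bar> \<le> (c\<^sup>2 + b\<^sup>2) / 2" and ab: "\<bar>a * b\<bar> \<le> (a\<^sup>2 + b\<^sup>2) / 2"
    by (rule *)+
  have b: "b\<^sup>2 \<ge> 0"
    by simp
  have "\<bar>(c - b) * b\<bar> = \<bar>c * b - b\<^sup>2\<bar>"
    by (simp add: algebra_simps power2_eq_square)
  also have "\<dots> \<le> (c\<^sup>2 + 3 * b\<^sup>2) / 2"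
    using abs_triangle_ineq4[of "c * b" "b\<^sup>2"] cb b by simp
  finally have "\<bar>(c - b) * b\<bar> \<le> (c\<^sup>2 + 3 * b\<^sup>2) / 2" .
  moreover have "\<bar>\<theta> * ((c - 2 * b + a) * b)\<bar> \<le> L * ((a\<^sup>2 + c\<^sup>2) / 2 + 3 * b\<^sup>2)"
    unfolding abs_mult[of \<theta>]
  proof (rule mult_mono)
    have "\<bar>(c - 2 * b + a) * b\<bar> = \<bar>(c * b - 2 * b\<^sup>2) + a * b\<bar>"
      by (simp add: algebra_simps power2_eq_square)
    also have "\<dots> \<le> (a\<^sup>2 + c\<^sup>2) / 2 + 3 * b\<^sup>2"
      using abs_triangle_ineq[of "c * b - 2 * b\<^sup>2" "a * b"]
        abs_triangle_ineq4[of "c * b" "2 * b\<^sup>2"] cb ab b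
      by (simp add: field_simps)
    finally show "\<bar>(c - 2 * b + a) * b\<bar> \<le> (a\<^sup>2 + c\<^sup>2) / 2 + 3 * b\<^sup>2" .
  qed (use assms in auto)
  moreover have "((c - b) - ((c - b) - (b - a)) * \<theta>) * b = (c - b) * b - \<theta> * ((c - 2 * b + a) * b)"
    by (simp add: algebra_simps)
  ultimately show ?thesis
    by linarith
qed

section \<open>The modulated energy in terms of the relative entropy\<close>

lemma deriv_h_tilde: "x > 0 \<Longrightarrow> deriv h_tilde x = ln x"
  unfolding h_tilde_def [abs_def]
  by (rule DERIV_imp_deriv) (auto intro!: derivative_eq_intros)

text \<open>The derivative of \<open>h_tilde\<close> at \<open>exp (- b)\<close> is
  \<open>- b\<close>, so the entropy bracket collapses to \<open>rel_entropy\<close>. Pulling out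
  \<open>mesh N\<close> leaves undivided differences.\<close>

lemma modulated_energy_eq:
  "modulated_energy \<epsilon> N \<rho> u \<phi> ub \<phi>b = mesh N *
     ((\<Sum>i\<in>{0..int N}. mean_half N \<rho> i * (val_half N u i - ub)\<^sup>2 / 2)
      + \<epsilon>\<^sup>2 / (2 * (mesh N)\<^sup>2) * (\<Sum>i\<in>{0..int N}. (val N \<phi> (i + 1) - val N \<phi> i)\<^sup>2)
      + (\<Sum>i\<in>{0..int N}. rel_entropy (val N \<phi> i) \<phi>b))"
proof -
  have "h_tilde (exp (- a)) - (h_tilde (exp (- b)) + deriv h_tilde (exp (- b)) * (exp (- a) - exp (- b)))
      = rel_entropy a b" for a b
    by (simp add: deriv_h_tilde) (simp add: h_tilde_def rel_entropy_def algebra_simps)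
  then show ?thesis
    unfolding modulated_energy_def
    by (simp add: sum_distrib_left sum_distrib_right distrib_left power_divide mult.commute
        mult.left_commute)
qed

section \<open>Lipschitz bounds for \<open>g\<close> and the density
  \<open>rho_tilde\<close>\<close>

text \<open>The infimum is attained: each difference quotient is a lower bound for all admissible
  constants.\<close>

lemma lipschitz_on_Lip:
  assumes "\<exists>L. L-lipschitz_on UNIV g"
  shows "(Lip g)-lipschitz_on UNIV g"
proof (rule lipschitz_onI)
  let ?A = "{L. L-lipschitz_on UNIV g}"
  have ne: "?A \<noteq> {}"
    using assms by auto
  show "dist (g x) (g y) \<le> Lip g * dist x y" for x y
  proof (cases "x = y")
    case False
    then have d: "dist x y > 0" by simp
    have "dist (g x) (g y) / dist x y \<le> Inf ?A"
    proof (rule cInf_greatest[OF ne])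
      fix L assume "L \<in> ?A"
      then have "dist (g x) (g y) \<le> L * dist x y"
        by (auto dest: lipschitz_onD)
      then show "dist (g x) (g y) / dist x y \<le> L"
        using d by (simp add: divide_simps)
    qed
    then show ?thesis
      using d by (simp add: Lip_def divide_simps)
  qed simp
  show "0 \<le> Lip g"
    unfolding Lip_def by (rule cInf_greatest[OF ne]) (auto dest: lipschitz_on_nonneg)
qed

text \<open>A function above the identity cannot grow with slope below 1. The bound makes division
  by \<open>Lip g\<close> meaningful in the restriction on the background velocity.\<close>

lemma lipschitz_ge_one:
  fixes g :: "real \<Rightarrow> real"
  assumes "L-lipschitz_on UNIV g" "\<forall>v. g v \<ge> max v 0"
  shows "L \<ge> 1"
proof (rule ccontr)
  assume "\<not> L \<ge> 1"
  \<comment> \<open>Chosen so that \<open>v * (1 - L)\<close> is \<open>g 0 + 1\<close>, beyond the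
    value \<open>g 0\<close> that the Lipschitz bound allows.\<close>
  define v where "v = (g 0 + 1) / (1 - L)"
  have g0: "g 0 \<ge> 0" and gv: "g v \<ge> v"
    using assms(2)[rule_format, of 0] assms(2)[rule_format, of v] by auto
  have v: "v > 0"
    using g0 \<open>\<not> L \<ge> 1\<close> by (simp add: v_def)
  have "dist (g v) (g 0) \<le> L * dist v 0"
    by (rule lipschitz_onD[OF assms(1)]) auto
  then have "v * (1 - L) \<le> g 0"
    using v gv by (simp add: dist_real_def algebra_simps)
  then show False
    using \<open>\<not> L \<ge> 1\<close> by (simp add: v_def)
qed

lemma abs_deriv_le_lipschitz:
  fixes g :: "real \<Rightarrow> real"
  assumes "L-lipschitz_on UNIV g" "g differentiable (at x)"
  shows "\<bar>deriv g x\<bar> \<le> L"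
proof -
  have "(g has_real_derivative deriv g x) (at x)"
    using assms(2) DERIV_deriv_iff_real_differentiable by blast
  then have "((\<lambda>y. \<bar>(g y - g x) / (y - x)\<bar>) \<longlongrightarrow> \<bar>deriv g x\<bar>) (at x)"
    unfolding has_field_derivative_iff by (rule tendsto_rabs)
  moreover have "\<forall>\<^sub>F y in at x. \<bar>(g y - g x) / (y - x)\<bar> \<le> L"
  proof (rule eventually_at_filter[THEN iffD2], rule always_eventually, intro allI impI)
    fix y assume "y \<noteq> x"
    moreover have "dist (g y) (g x) \<le> L * dist y x"
      using assms(1) by (auto dest: lipschitz_onD)
    ultimately show "\<bar>(g y - g x) / (y - x)\<bar> \<le> L"
      by (simp add: dist_real_def abs_divide divide_simps)
  qed
  ultimately show ?thesis
    by (rule tendsto_upperbound) simp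
qed

text \<open>Multiplying by the velocity undoes the division in \<open>rho_tilde\<close>, and the
  subtracted flux at velocity 0 is \<open>g 0\<close> times a density difference. That remainder
  acts as numerical diffusion.\<close>

lemma rho_tilde_times_velocity:
  "rho_tilde g N \<rho> u i * val_half N u i
    = flux_half g N \<rho> u i + g 0 * (val N \<rho> (i + 1) - val N \<rho> i)"
  by (cases "val_half N u i = 0")
    (simp_all add: rho_tilde_def flux_half_def G_def, simp_all add: algebra_simps)

text \<open>Here \<theta> is the difference quotient of \<open>g\<close> between 0 and the velocity,
  or its limit \<open>deriv g 0\<close> when the velocity vanishes.\<close>

lemma rho_tilde_interpolation:
  assumes "L-lipschitz_on UNIV g" "g differentiable (at 0)"
  obtains \<theta> where "\<bar>\<theta>\<bar> \<le> L"
    "rho_tilde g N \<rho> u i = val N \<rho> (i + 1) - (val N \<rho> (i + 1) - val N \<rho> i) * \<theta>"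
proof (cases "val_half N u i = 0")
  case True
  show ?thesis
    by (rule that[of "deriv g 0"])
      (use True abs_deriv_le_lipschitz[OF assms] in \<open>auto simp: rho_tilde_def\<close>)
next
  case False
  let ?v = "val_half N u i"
  have "dist (g ?v) (g 0) \<le> L * dist ?v 0"
    by (rule lipschitz_onD[OF assms(1)]) auto
  then have "\<bar>(g ?v - g 0) / ?v\<bar> \<le> L"
    using False by (simp add: dist_real_def abs_divide divide_simps)
  moreover have "rho_tilde g N \<rho> u i
      = val N \<rho> (i + 1) - (val N \<rho> (i + 1) - val N \<rho> i) * ((g ?v - g 0) / ?v)"
    using False by (simp add: rho_tilde_def G_def field_simps)
  ultimately show ?thesis
    by (rule that)
qed

section \<open>One implicit time step\<close>

text \<open>A suffix 0 marks the old time level. The Poisson equation is assumed at both levels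
  because the energy estimate subtracts the two.\<close>

locale implicit_step =
  fixes g :: "real \<Rightarrow> real" and L \<epsilon> \<tau> :: real and N :: nat
    and \<rho> u \<phi> \<rho>0 u0 \<phi>0 :: "real \<Rightarrow> real"
  assumes torus: "torus_fun \<rho>" "torus_fun u" "torus_fun \<phi>" "torus_fun \<rho>0" "torus_fun u0" "torus_fun \<phi>0"
    and rho_pos: "\<And>x. \<rho> x > 0" and rho0_pos: "\<And>x. \<rho>0 x > 0"
    and eps_pos: "\<epsilon> > 0" and tau_pos: "\<tau> > 0"
    and lipschitz: "L-lipschitz_on UNIV g" and g_diff: "g differentiable (at 0)"
    and g_ge: "\<forall>v. g v \<ge> max v 0"
    and mass_on_period: "\<forall>i\<in>{0..int N}. (val N \<rho> i - val N \<rho>0 i) / \<tau>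
           + (flux_half g N \<rho> u i - flux_half g N \<rho> u (i - 1)) / mesh N = 0"
    and momentum_on_period: "\<forall>i\<in>{0..int N}.
           (mean_half N \<rho> i * val_half N u i - mean_half N \<rho>0 i * val_half N u0 i) / \<tau>
           + (flux g N \<rho> u (i + 1) * upwind g N \<rho> u (i + 1) - flux g N \<rho> u i * upwind g N \<rho> u i) / mesh N
           = rho_tilde g N \<rho> u i * dgrad N \<phi> i"
    and poisson_on_period: "discrete_poisson \<epsilon> N \<rho> \<phi>" "discrete_poisson \<epsilon> N \<rho>0 \<phi>0"
begin

abbreviation "h \<equiv> mesh N"
abbreviation "r \<equiv> val N \<rho>"
abbreviation "r0 \<equiv> val N \<rho>0"
abbreviation "v \<equiv> val_half N u"
abbreviation "v0 \<equiv> val_half N u0"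
abbreviation "p \<equiv> val N \<phi>"
abbreviation "p0 \<equiv> val N \<phi>0"
abbreviation "F \<equiv> flux_half g N \<rho> u"
abbreviation "M \<equiv> flux g N \<rho> u"
abbreviation "U \<equiv> upwind g N \<rho> u"
abbreviation "R \<equiv> rho_tilde g N \<rho> u"
text \<open>Differences are not divided by \<open>h\<close>: \<open>lap i\<close> is the discrete
  Laplacian times the square of \<open>h\<close>, and the powers of \<open>h\<close> appear as
  explicit factors.\<close>

abbreviation "d i \<equiv> p (i + 1) - p i"
abbreviation "d0 i \<equiv> p0 (i + 1) - p0 i"
abbreviation "lap i \<equiv> d i - d (i - 1)"
abbreviation "Q i \<equiv> d i * (exp (- p i) - exp (- p (i + 1)))"
abbreviation "S f \<equiv> (\<Sum>i\<in>{0..int N}. f i)"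

lemma periodic_vals:
  "periodic N r" "periodic N r0" "periodic N v" "periodic N v0" "periodic N p" "periodic N p0"
  by (intro periodic_val periodic_val_half torus)+

lemmas periodic_vals_shift =
  periodic_vals periodic_vals[THEN periodic_shift] periodic_vals[THEN periodic_shift_minus]

lemma periodic_F: "periodic N F"
proof -
  have "periodic N (\<lambda>i. g (v i))"
    using periodic_comp[OF periodic_vals(3)] .
  then show ?thesis
    unfolding flux_half_def[abs_def] G_def by (intro periodic_arith periodic_vals_shift)
qed

lemma periodic_M: "periodic N M"
  unfolding flux_def[abs_def] by (intro periodic_arith periodic_F periodic_shift_minus[OF periodic_F])

lemma periodic_U: "periodic N U"
  unfolding upwind_def[abs_def]
  by (intro periodic_if periodic_arith periodic_M periodic_vals_shift)

lemma periodic_d: "periodic N d"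
  by (intro periodic_arith periodic_vals_shift)

lemma periodic_d0: "periodic N d0"
  by (intro periodic_arith periodic_vals_shift)

lemma mass: "r i - r0 i = - (\<tau> / h) * (F i - F (i - 1))"
proof -
  have "(r i - r0 i) / \<tau> + (F i - F (i - 1)) / h = 0"
    by (rule periodic_ball_imp_all[OF _ mass_on_period])
      (intro periodic_arith periodic_F periodic_shift_minus[OF periodic_F] periodic_vals_shift)
  then show ?thesis
    using tau_pos mesh_pos[of N] by (simp add: field_simps)
qed

text \<open>Averaging the mass balances of two neighbouring cells gives one on the staggered cell,
  since \<open>M\<close> is the average of two neighbouring \<open>F\<close>.\<close>

lemma dual_mass: "mean_half N \<rho> i - mean_half N \<rho>0 i = - (\<tau> / h) * (M (i + 1) - M i)"
proof -
  have "mean_half N \<rho> i - mean_half N \<rho>0 i = ((r i - r0 i) + (r (i + 1) - r0 (i + 1))) / 2"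
    by (simp add: mean_half_def field_simps)
  then show ?thesis
    unfolding mass using mesh_pos[of N] by (simp add: flux_def field_simps)
qed

lemma momentum:
  assumes "i \<in> {0..int N}"
  shows "mean_half N \<rho> i * v i - mean_half N \<rho>0 i * v0 i
    = (\<tau> / h) * (R i * d i - (M (i + 1) * U (i + 1) - M i * U i))"
proof -
  have "(mean_half N \<rho> i * v i - mean_half N \<rho>0 i * v0 i) / \<tau>
      = (R i * d i - (M (i + 1) * U (i + 1) - M i * U i)) / h"
    using momentum_on_period[rule_format, OF assms]
    by (simp add: dgrad_def diff_divide_distrib right_diff_distrib)
  then show ?thesis
    using tau_pos by (simp add: field_simps)
qed

lemma poisson: "r i = \<epsilon>\<^sup>2 / h\<^sup>2 * lap i + exp (- p i)"
  and poisson0: "r0 i = \<epsilon>\<^sup>2 / h\<^sup>2 * (d0 i - d0 (i - 1)) + exp (- p0 i)"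
proof -
  have "\<epsilon>\<^sup>2 * dlaplace N \<phi> i + exp (- p i) = r i"
    by (rule periodic_ball_imp_all[OF _ poisson_on_period(1)[unfolded discrete_poisson_def]])
      (unfold dlaplace_def, intro periodic_arith periodic_vals_shift)
  then show "r i = \<epsilon>\<^sup>2 / h\<^sup>2 * lap i + exp (- p i)"
    by (simp add: dlaplace_def algebra_simps add_divide_distrib diff_divide_distrib)
  have "\<epsilon>\<^sup>2 * dlaplace N \<phi>0 i + exp (- p0 i) = r0 i"
    by (rule periodic_ball_imp_all[OF _ poisson_on_period(2)[unfolded discrete_poisson_def]])
      (unfold dlaplace_def, intro periodic_arith periodic_vals_shift)
  then show "r0 i = \<epsilon>\<^sup>2 / h\<^sup>2 * (d0 i - d0 (i - 1)) + exp (- p0 i)"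
    by (simp add: dlaplace_def algebra_simps add_divide_distrib diff_divide_distrib)
qed

text \<open>The upwind choice makes the bracket half the squared velocity jump, with the sign of
  \<open>M i\<close>.\<close>

lemma upwind_dissipation:
  "0 \<le> M i * ((U i - c) * ((v (i - 1) - c) - (v i - c)) - ((v (i - 1) - c)\<^sup>2 - (v i - c)\<^sup>2) / 2)"
proof -
  have "M i * ((U i - c) * ((v (i - 1) - c) - (v i - c)) - ((v (i - 1) - c)\<^sup>2 - (v i - c)\<^sup>2) / 2)
      = \<bar>M i\<bar> * (v (i - 1) - v i)\<^sup>2 / 2"
    by (simp add: upwind_def power2_eq_square algebra_simps) (simp add: field_simps)
  also have "\<dots> \<ge> 0"
    by simp
  finally show ?thesis .
qed

section \<open>Kinetic energy\<close>

lemma kinetic_energy_increment: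
  "S (\<lambda>i. mean_half N \<rho> i * (v i - c)\<^sup>2 / 2) - S (\<lambda>i. mean_half N \<rho>0 i * (v0 i - c)\<^sup>2 / 2)
    \<le> (\<tau> / h) * (S (\<lambda>i. R i * d i * v i) - c * S (\<lambda>i. R i * d i))"
proof -
  define w w0 W where "w i = v i - c" and "w0 i = v0 i - c" and "W i = U i - c" for i
  define l where "l = \<tau> / h"
  have l: "l > 0"
    using tau_pos mesh_pos[of N] by (simp add: l_def)
  have step: "mean_half N \<rho> i * (w i)\<^sup>2 / 2 - mean_half N \<rho>0 i * (w0 i)\<^sup>2 / 2
      \<le> l * (R i * d i * w i - (M (i + 1) * (w i * W (i + 1) - (w i)\<^sup>2 / 2)
                - M i * (w i * W i - (w i)\<^sup>2 / 2)))"
    if i: "i \<in> {0..int N}" for i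
  proof -
    let ?A = "mean_half N \<rho> i" and ?B = "mean_half N \<rho>0 i"
    have B: "?B \<ge> 0"
      using rho0_pos[of "node N i"] rho0_pos[of "node N (i + 1)"] by (simp add: mean_half_def val_def)
    have AB: "?A - ?B = - l * (M (i + 1) - M i)"
      using dual_mass by (simp add: l_def)
    \<comment> \<open>Subtracting \<open>c\<close> times the staggered mass balance turns the
      momentum balance into one for the relative velocity \<open>w\<close>.\<close>
    have "?A * w i - ?B * w0 i = (?A * v i - ?B * v0 i) - c * (?A - ?B)"
      by (simp add: w_def w0_def algebra_simps)
    also have "\<dots> = l * (R i * d i - (M (i + 1) * W (i + 1) - M i * W i))"
      unfolding momentum[OF i] AB by (simp add: l_def[symmetric] W_def algebra_simps)
    finally have mom: "?A * w i - ?B * w0 i = l * (R i * d i - (M (i + 1) * W (i + 1) - M i * W i))" .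
    \<comment> \<open>Discrete product rule of the implicit step; the discarded square has the old
      density as its weight.\<close>
    have "?A * (w i)\<^sup>2 / 2 - ?B * (w0 i)\<^sup>2 / 2
        = w i * (?A * w i - ?B * w0 i) - ?B * (w i - w0 i)\<^sup>2 / 2 - (?A - ?B) * (w i)\<^sup>2 / 2"
      by (simp add: field_simps power2_eq_square)
    also have "\<dots> \<le> w i * (?A * w i - ?B * w0 i) - (?A - ?B) * (w i)\<^sup>2 / 2"
      using B by simp
    also have "\<dots> = l * (R i * d i * w i - (M (i + 1) * (w i * W (i + 1) - (w i)\<^sup>2 / 2)
                - M i * (w i * W i - (w i)\<^sup>2 / 2)))"
      unfolding mom AB by (simp add: field_simps power2_eq_square)
    finally show ?thesis .
  qed
  \<comment> \<open>Moving the flux at \<open>i + 1\<close> to index \<open>i\<close> pairs the two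
    velocities adjacent to one cell centre, as the upwind estimate requires.\<close>
  have "periodic N (\<lambda>i. M i * (w (i - 1) * W i - (w (i - 1))\<^sup>2 / 2))"
    unfolding w_def W_def
    by (intro periodic_arith periodic_M periodic_U periodic_vals_shift)
  from sum_periodic_shift[OF this]
  have shift: "S (\<lambda>i. M (i + 1) * (w i * W (i + 1) - (w i)\<^sup>2 / 2))
      = S (\<lambda>i. M i * (w (i - 1) * W i - (w (i - 1))\<^sup>2 / 2))"
    by simp
  have "0 \<le> S (\<lambda>i. M i * (W i * (w (i - 1) - w i) - ((w (i - 1))\<^sup>2 - (w i)\<^sup>2) / 2))"
    unfolding w_def W_def by (intro sum_nonneg upwind_dissipation)
  also have "\<dots> = S (\<lambda>i. M i * (w (i - 1) * W i - (w (i - 1))\<^sup>2 / 2) - M i * (w i * W i - (w i)\<^sup>2 / 2))"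
    by (rule sum.cong) (simp_all add: field_simps)
  finally have transport: "0 \<le> S (\<lambda>i. M (i + 1) * (w i * W (i + 1) - (w i)\<^sup>2 / 2))
      - S (\<lambda>i. M i * (w i * W i - (w i)\<^sup>2 / 2))"
    by (simp add: shift sum_subtractf)
  have "S (\<lambda>i. mean_half N \<rho> i * (w i)\<^sup>2 / 2) - S (\<lambda>i. mean_half N \<rho>0 i * (w0 i)\<^sup>2 / 2)
      \<le> S (\<lambda>i. l * (R i * d i * w i - (M (i + 1) * (w i * W (i + 1) - (w i)\<^sup>2 / 2)
                - M i * (w i * W i - (w i)\<^sup>2 / 2))))"
    unfolding sum_subtractf[symmetric] by (rule sum_mono) (rule step)
  also have "\<dots> = l * (S (\<lambda>i. R i * d i * w i) - (S (\<lambda>i. M (i + 1) * (w i * W (i + 1) - (w i)\<^sup>2 / 2))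
      - S (\<lambda>i. M i * (w i * W i - (w i)\<^sup>2 / 2))))"
    by (simp add: sum_subtractf flip: sum_distrib_left)
  also have "\<dots> \<le> l * S (\<lambda>i. R i * d i * w i)"
    using transport l by simp
  also have "S (\<lambda>i. R i * d i * w i) = S (\<lambda>i. R i * d i * v i) - c * S (\<lambda>i. R i * d i)"
    unfolding w_def sum_distrib_left sum_subtractf[symmetric]
    by (rule sum.cong) (simp_all add: algebra_simps)
  finally show ?thesis
    by (simp add: w_def w0_def l_def)
qed

section \<open>Potential energy\<close>

text \<open>Laplacians and flux differences sum to zero, so electron mass equals ion mass at both
  levels and ion mass is conserved. This removes the term linear in the background potential from
  the entropy balance.\<close>

lemma total_electron_mass: "S (\<lambda>i. exp (- p i)) = S (\<lambda>i. exp (- p0 i))"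
proof -
  have r: "S r = S (\<lambda>i. exp (- p i))"
    using sum_periodic_shift_minus[OF periodic_d]
    by (simp only: poisson sum.distrib sum_distrib_left[symmetric] sum_subtractf[of d]) simp
  have r0: "S r0 = S (\<lambda>i. exp (- p0 i))"
    using sum_periodic_shift_minus[OF periodic_d0]
    by (simp only: poisson0 sum.distrib sum_distrib_left[symmetric] sum_subtractf[of d0]) simp
  have "S (\<lambda>i. r i - r0 i) = 0"
    by (simp only: mass sum_distrib_left[symmetric] sum_subtractf sum_periodic_shift_minus[OF periodic_F])
      simp
  then show ?thesis
    using r r0 by (simp add: sum_subtractf)
qed

text \<open>Summation by parts and mass balance turn the left side into the potential tested against
  the density increment. The Poisson equation splits it into a field part and an electron part, each
  estimated by convexity.\<close>

lemma potential_energy_increment: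
  "(\<tau> / h) * S (\<lambda>i. F i * d i)
    \<le> \<epsilon>\<^sup>2 / (2 * h\<^sup>2) * (S (\<lambda>i. (d0 i)\<^sup>2) - S (\<lambda>i. (d i)\<^sup>2))
      + (S (\<lambda>i. rel_entropy (p0 i) b) - S (\<lambda>i. rel_entropy (p i) b))"
proof -
  define e where "e = \<epsilon>\<^sup>2 / h\<^sup>2"
  have e: "e \<ge> 0"
    by (simp add: e_def)
  have "(\<tau> / h) * S (\<lambda>i. F i * d i) = - (\<tau> / h) * S (\<lambda>i. p i * (F i - F (i - 1)))"
    using sum_by_parts_periodic[OF periodic_F periodic_vals(5)] by simp
  also have "\<dots> = S (\<lambda>i. p i * (r i - r0 i))"
    unfolding mass sum_distrib_left by (rule sum.cong) simp_all
  also have "\<dots> = e * S (\<lambda>i. p i * ((d i - d0 i) - (d (i - 1) - d0 (i - 1))))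
      + S (\<lambda>i. p i * (exp (- p i) - exp (- p0 i)))"
    unfolding poisson poisson0 e_def[symmetric] sum_distrib_left sum.distrib[symmetric]
    by (rule sum.cong) (simp_all add: algebra_simps)
  also have "S (\<lambda>i. p i * ((d i - d0 i) - (d (i - 1) - d0 (i - 1)))) = - S (\<lambda>i. (d i - d0 i) * d i)"
  proof -
    have "periodic N (\<lambda>i. d i - d0 i)"
      by (intro periodic_arith periodic_d periodic_d0)
    from sum_by_parts_periodic[OF this periodic_vals(5)] show ?thesis
      by simp
  qed
  finally have eq: "(\<tau> / h) * S (\<lambda>i. F i * d i)
      = - e * S (\<lambda>i. (d i - d0 i) * d i) + S (\<lambda>i. p i * (exp (- p i) - exp (- p0 i)))"
    by simp
  have "S (\<lambda>i. ((d i)\<^sup>2 - (d0 i)\<^sup>2) / 2) \<le> S (\<lambda>i. (d i - d0 i) * d i)"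
  proof (rule sum_mono)
    have "(x\<^sup>2 - y\<^sup>2) / 2 \<le> (x - y) * x" for x y :: real
      using zero_le_power2[of "x - y"] by (simp add: power2_eq_square field_simps)
    then show "((d i)\<^sup>2 - (d0 i)\<^sup>2) / 2 \<le> (d i - d0 i) * d i" for i .
  qed
  then have "e * S (\<lambda>i. ((d i)\<^sup>2 - (d0 i)\<^sup>2) / 2) \<le> e * S (\<lambda>i. (d i - d0 i) * d i)"
    using e by (rule mult_left_mono)
  then have field: "- e * S (\<lambda>i. (d i - d0 i) * d i) \<le> e / 2 * (S (\<lambda>i. (d0 i)\<^sup>2) - S (\<lambda>i. (d i)\<^sup>2))"
    by (simp only: sum_divide_distrib[symmetric] sum_subtractf[of "\<lambda>i. (d i)\<^sup>2"])
      (simp add: right_diff_distrib)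
  have "S (\<lambda>i. p i * (exp (- p i) - exp (- p0 i)))
      \<le> S (\<lambda>i. rel_entropy (p0 i) b - rel_entropy (p i) b + b * (exp (- p i) - exp (- p0 i)))"
    by (rule sum_mono) (rule exp_increment_le_rel_entropy_diff)
  also have "\<dots> = S (\<lambda>i. rel_entropy (p0 i) b) - S (\<lambda>i. rel_entropy (p i) b)"
    using total_electron_mass by (simp add: sum.distrib sum_subtractf flip: sum_distrib_left)
  finally show ?thesis
    using eq field by (simp add: e_def)
qed

section \<open>Dissipation and the maximum principle\<close>

text \<open>After summation by parts and insertion of the Poisson equation, the field part is minus
  a sum of squares and is dropped; the electron part is summed by parts back.\<close>

lemma density_potential_dissipation: "S (\<lambda>i. (r (i + 1) - r i) * d i) \<le> - S Q"
proof -
  define e where "e = \<epsilon>\<^sup>2 / h\<^sup>2"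
  have pe: "periodic N (\<lambda>i. exp (- p i))"
    by (intro periodic_arith periodic_vals_shift)
  have "S (\<lambda>i. d i * (r (i + 1) - r i)) = - S (\<lambda>i. r i * lap i)"
    using sum_by_parts_periodic[OF periodic_d periodic_vals(1)] .
  also have "\<dots> = - e * S (\<lambda>i. (lap i)\<^sup>2) - S (\<lambda>i. exp (- p i) * lap i)"
    unfolding poisson e_def[symmetric] sum_distrib_left sum_negf[symmetric] sum_subtractf[symmetric]
    by (rule sum.cong) (simp_all add: algebra_simps power2_eq_square)
  also have "\<dots> \<le> - S (\<lambda>i. exp (- p i) * lap i)"
    by (simp add: e_def sum_nonneg)
  also have "\<dots> = S (\<lambda>i. d i * (exp (- p (i + 1)) - exp (- p i)))"
    using sum_by_parts_periodic[OF periodic_d pe] by simp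
  also have "\<dots> = - S Q"
    unfolding sum_negf[symmetric] by (rule sum.cong) (simp_all add: algebra_simps)
  finally show ?thesis
    by (simp add: mult.commute)
qed

text \<open>At a minimum of the potential the Laplacian is nonnegative, so the largest electron
  density is at most the ion density there.\<close>

lemma electron_density_le:
  assumes "\<And>i. r i \<le> K"
  shows "exp (- p i) \<le> K"
proof -
  obtain j where "j \<in> {0..int N}" and j: "\<forall>k\<in>{0..int N}. p j \<le> p k"
    using ex_min_if_finite[of "p ` {0..int N}"] by (auto simp: not_less)
  have min: "p j \<le> p k" for k
    by (rule periodic_ball_imp_all[OF _ j]) (intro periodic_arith periodic_vals_shift)
  have "0 \<le> \<epsilon>\<^sup>2 / h\<^sup>2 * lap j"
    using min[of "j + 1"] min[of "j - 1"] by (intro mult_nonneg_nonneg) auto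
  then have "exp (- p j) \<le> K"
    using poisson[of j] assms[of j] by simp
  moreover have "exp (- p i) \<le> exp (- p j)"
    using min by simp
  ultimately show ?thesis
    by (rule order_trans[rotated])
qed

section \<open>The drift caused by the background velocity\<close>

lemma drift_le:
  assumes K: "\<And>i. r i \<le> K"
  shows "\<bar>S (\<lambda>i. R i * d i)\<bar>
    \<le> (\<epsilon>\<^sup>2 / h\<^sup>2 * (2 + 4 * L) + K) * S (\<lambda>i. (d i)\<^sup>2) + L * S Q"
proof -
  define e where "e = \<epsilon>\<^sup>2 / h\<^sup>2"
  have e: "e \<ge> 0"
    by (simp add: e_def)
  let ?\<psi> = "\<lambda>i. exp (- p i)"
  have pe: "periodic N ?\<psi>"
    by (intro periodic_arith periodic_vals_shift)
  have pd: "periodic N (\<lambda>i. (d i)\<^sup>2)"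
    by (intro periodic_arith periodic_d)
  \<comment> \<open>The added difference of \<open>?\<psi>\<close> telescopes to zero over the
    period, and it removes the first-order part of the electron contribution.\<close>
  have point: "\<bar>R i * d i + (?\<psi> (i + 1) - ?\<psi> i)\<bar>
      \<le> e * (((d (i + 1))\<^sup>2 + 3 * (d i)\<^sup>2) / 2
             + L * (((d (i - 1))\<^sup>2 + (d (i + 1))\<^sup>2) / 2 + 3 * (d i)\<^sup>2))
        + (L * Q i + K * (d i)\<^sup>2)" for i
  proof -
    obtain \<theta> where \<theta>: "\<bar>\<theta>\<bar> \<le> L" and R: "R i = r (i + 1) - (r (i + 1) - r i) * \<theta>"
      by (rule rho_tilde_interpolation[OF lipschitz g_diff])
    define A where "A = ((d (i + 1) - d i) - ((d (i + 1) - d i) - (d i - d (i - 1))) * \<theta>) * d i"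
    define B where "B = (?\<psi> (i + 1) - (?\<psi> (i + 1) - ?\<psi> i) * \<theta>) * d i + (?\<psi> (i + 1) - ?\<psi> i)"
    have eq: "R i * d i + (?\<psi> (i + 1) - ?\<psi> i) = e * A + B"
    proof -
      have r1: "r (i + 1) = e * (d (i + 1) - d i) + ?\<psi> (i + 1)"
        using poisson[of "i + 1"] by (simp add: e_def)
      have r: "r i = e * (d i - d (i - 1)) + ?\<psi> i"
        using poisson[of i] unfolding e_def .
      have "((e * x1 + y1) - ((e * x1 + y1) - (e * x0 + y0)) * \<theta>) * z + (y1 - y0)
          = e * ((x1 - (x1 - x0) * \<theta>) * z) + ((y1 - (y1 - y0) * \<theta>) * z + (y1 - y0))"
        for x0 x1 y0 y1 z :: real
        by (simp add: algebra_simps)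
      then show ?thesis
        unfolding R r1 r A_def B_def .
    qed
    have A: "\<bar>e * A\<bar> \<le> e * (((d (i + 1))\<^sup>2 + 3 * (d i)\<^sup>2) / 2
             + L * (((d (i - 1))\<^sup>2 + (d (i + 1))\<^sup>2) / 2 + 3 * (d i)\<^sup>2))"
      unfolding abs_mult[of e] A_def abs_of_nonneg[OF e]
      by (rule mult_left_mono[OF third_difference_product_le[OF \<theta>] e])
    have B: "\<bar>B\<bar> \<le> L * Q i + K * (d i)\<^sup>2"
    proof -
      have "\<bar>B\<bar> \<le> (L + 1) * Q i"
        unfolding B_def by (rule quadrature_error_le[OF \<theta>])
      also have "\<dots> = L * Q i + Q i"
        by (simp only: distrib_right mult_1)
      \<comment> \<open>Only one copy of \<open>Q i\<close> is traded for the field energy;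
        \<open>L * Q i\<close> is kept to be absorbed by the dissipation.\<close>
      also have "\<dots> \<le> L * Q i + K * (d i)\<^sup>2"
        by (intro add_left_mono exp_jump_le electron_density_le K)
      finally show ?thesis .
    qed
    show ?thesis
      unfolding eq by (rule order_trans[OF abs_triangle_ineq add_mono[OF A B]])
  qed
  have split: "S (\<lambda>i. e * ((a i + 3 * b i) / 2 + L * ((c i + a i) / 2 + 3 * b i)) + (L * q i + K * b i))
      = e * ((S a + 3 * S b) / 2 + L * ((S c + S a) / 2 + 3 * S b)) + (L * S q + K * S b)"
    for a b c q :: "int \<Rightarrow> real"
    by (simp only: sum.distrib sum_distrib_left[symmetric] sum_divide_distrib[symmetric])
  have combine: "e * ((x + 3 * x) / 2 + L * ((x + x) / 2 + 3 * x)) + (L * y + K * x)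
      = (e * (2 + 4 * L) + K) * x + L * y" for x y
    by (simp add: algebra_simps)
  have "\<bar>S (\<lambda>i. R i * d i)\<bar> = \<bar>S (\<lambda>i. R i * d i + (?\<psi> (i + 1) - ?\<psi> i))\<bar>"
    unfolding sum.distrib sum_subtractf[of "\<lambda>i. ?\<psi> (i + 1)"] sum_periodic_shift[OF pe] by simp
  also have "\<dots> \<le> S (\<lambda>i. \<bar>R i * d i + (?\<psi> (i + 1) - ?\<psi> i)\<bar>)"
    by (rule sum_abs)
  also have "\<dots> \<le> S (\<lambda>i. e * (((d (i + 1))\<^sup>2 + 3 * (d i)\<^sup>2) / 2
             + L * (((d (i - 1))\<^sup>2 + (d (i + 1))\<^sup>2) / 2 + 3 * (d i)\<^sup>2))
        + (L * Q i + K * (d i)\<^sup>2))"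
    by (rule sum_mono) (rule point)
  also have "\<dots> = e * ((S (\<lambda>i. (d (i + 1))\<^sup>2) + 3 * S (\<lambda>i. (d i)\<^sup>2)) / 2
             + L * ((S (\<lambda>i. (d (i - 1))\<^sup>2) + S (\<lambda>i. (d (i + 1))\<^sup>2)) / 2 + 3 * S (\<lambda>i. (d i)\<^sup>2)))
        + (L * S Q + K * S (\<lambda>i. (d i)\<^sup>2))"
    by (rule split)
  also have "\<dots> = (e * (2 + 4 * L) + K) * S (\<lambda>i. (d i)\<^sup>2) + L * S Q"
    unfolding sum_periodic_shift[OF pd] sum_periodic_shift_minus[OF pd] by (rule combine)
  finally show ?thesis
    unfolding e_def .
qed

section \<open>The one-step energy inequality\<close>

lemma modulated_energy_step:
  assumes K: "\<And>i. r i \<le> K" and ub: "\<bar>ub\<bar> * L \<le> g 0"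
  shows "(1 - \<bar>ub\<bar> * (\<tau> / h) * (8 * L + 4 + 2 * h\<^sup>2 / \<epsilon>\<^sup>2 * K))
           * modulated_energy \<epsilon> N \<rho> u \<phi> ub \<phi>b
         \<le> modulated_energy \<epsilon> N \<rho>0 u0 \<phi>0 ub \<phi>b"
proof -
  define l where "l = \<tau> / h"
  define e where "e = \<epsilon>\<^sup>2 / h\<^sup>2"
  define D where "D = S (\<lambda>i. (d i)\<^sup>2)"
  define Kin where "Kin = S (\<lambda>i. mean_half N \<rho> i * (v i - ub)\<^sup>2 / 2)"
  define Ent where "Ent = S (\<lambda>i. rel_entropy (p i) \<phi>b)"
  define C where "C = 8 * L + 4 + 2 * h\<^sup>2 / \<epsilon>\<^sup>2 * K"
  define E where "E = Kin + e / 2 * D + Ent"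
  define D0 where "D0 = S (\<lambda>i. (d0 i)\<^sup>2)"
  define Kin0 where "Kin0 = S (\<lambda>i. mean_half N \<rho>0 i * (v0 i - ub)\<^sup>2 / 2)"
  define Ent0 where "Ent0 = S (\<lambda>i. rel_entropy (p0 i) \<phi>b)"
  define E0 where "E0 = Kin0 + e / 2 * D0 + Ent0"
  have h: "h > 0" by (rule mesh_pos)
  have l: "l > 0"
    using tau_pos h by (simp add: l_def)
  have e: "e > 0"
    using eps_pos h by (simp add: e_def)
  have L: "L \<ge> 0"
    using lipschitz lipschitz_on_nonneg by blast
  have "K \<ge> 0"
    using K[of 0] rho_pos[of "node N 0"] by (simp add: val_def)
  then have C: "C \<ge> 0"
    using L by (simp add: C_def)
  have g0: "g 0 \<ge> 0"
    using g_ge[rule_format, of 0] by simp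
  \<comment> \<open>This fixes the constants of the CFL number: \<open>C\<close> times the field
    energy weight \<open>e / 2\<close> is the coefficient in \<open>drift_le\<close>.\<close>
  have eC: "e / 2 * C = e * (2 + 4 * L) + K"
    using h eps_pos by (simp add: e_def C_def field_simps)
  have SQ: "S Q \<ge> 0"
    by (intro sum_nonneg exp_jump_nonneg)
  have "mean_half N \<rho> i \<ge> 0" for i
    using rho_pos[of "node N i"] rho_pos[of "node N (i + 1)"] by (simp add: mean_half_def val_def)
  then have "Kin \<ge> 0"
    unfolding Kin_def by (intro sum_nonneg) simp
  moreover have "Ent \<ge> 0"
    unfolding Ent_def by (intro sum_nonneg rel_entropy_nonneg)
  ultimately have DE: "e / 2 * D \<le> E"
    by (simp add: E_def)
  have "S (\<lambda>i. R i * d i * v i) = S (\<lambda>i. F i * d i + g 0 * ((r (i + 1) - r i) * d i))"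
  proof (rule sum.cong[OF refl])
    fix i
    have "R i * d i * v i = (R i * v i) * d i"
      by simp
    also have "\<dots> = F i * d i + g 0 * ((r (i + 1) - r i) * d i)"
      unfolding rho_tilde_times_velocity by (simp add: algebra_simps)
    finally show "R i * d i * v i = F i * d i + g 0 * ((r (i + 1) - r i) * d i)" .
  qed
  also have "\<dots> = S (\<lambda>i. F i * d i) + g 0 * S (\<lambda>i. (r (i + 1) - r i) * d i)"
    by (simp add: sum.distrib sum_distrib_left)
  also have "\<dots> \<le> S (\<lambda>i. F i * d i) + g 0 * (- S Q)"
    using density_potential_dissipation g0 by (intro add_left_mono mult_left_mono)
  finally have power: "S (\<lambda>i. R i * d i * v i) \<le> S (\<lambda>i. F i * d i) - g 0 * S Q"
    by simp
  have "- ub * S (\<lambda>i. R i * d i) \<le> \<bar>ub\<bar> * \<bar>S (\<lambda>i. R i * d i)\<bar>"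
    using abs_ge_self[of "- ub * S (\<lambda>i. R i * d i)"] by (simp only: abs_mult abs_minus_cancel)
  also have "\<dots> \<le> \<bar>ub\<bar> * ((e * (2 + 4 * L) + K) * D + L * S Q)"
    using drift_le[OF K] unfolding D_def e_def by (rule mult_left_mono) simp
  also have "\<dots> = \<bar>ub\<bar> * C * (e / 2 * D) + \<bar>ub\<bar> * L * S Q"
    unfolding eC[symmetric] by (simp add: algebra_simps)
  \<comment> \<open>The bound on the background velocity enters here: the \<open>Q\<close> term
    becomes \<open>g 0 * S Q\<close>, which cancels the dissipation in \<open>power\<close>.\<close>
  also have "\<dots> \<le> \<bar>ub\<bar> * C * E + g 0 * S Q"
    using DE ub SQ C by (intro add_mono mult_left_mono mult_right_mono) auto
  finally have drift: "- ub * S (\<lambda>i. R i * d i) \<le> \<bar>ub\<bar> * C * E + g 0 * S Q" .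
  have "S (\<lambda>i. R i * d i * v i) - ub * S (\<lambda>i. R i * d i) \<le> S (\<lambda>i. F i * d i) + \<bar>ub\<bar> * C * E"
    using power drift by simp
  from mult_left_mono[OF this less_imp_le[OF l]]
  have "l * (S (\<lambda>i. R i * d i * v i) - ub * S (\<lambda>i. R i * d i))
      \<le> l * S (\<lambda>i. F i * d i) + \<bar>ub\<bar> * l * C * E"
    by (simp only: distrib_left mult_ac)
  moreover have "l * S (\<lambda>i. F i * d i) \<le> e / 2 * (D0 - D) + (Ent0 - Ent)"
    using potential_energy_increment[of \<phi>b]
    by (simp add: l_def e_def D_def D0_def Ent_def Ent0_def)
  moreover have "Kin - Kin0 \<le> l * (S (\<lambda>i. R i * d i * v i) - ub * S (\<lambda>i. R i * d i))"
    using kinetic_energy_increment[of ub] unfolding l_def Kin_def Kin0_def .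
  moreover have "E - E0 = (Kin - Kin0) - e / 2 * (D0 - D) - (Ent0 - Ent)"
    by (simp add: E_def E0_def right_diff_distrib)
  ultimately have "E - E0 \<le> \<bar>ub\<bar> * l * C * E"
    by linarith
  then have "(1 - \<bar>ub\<bar> * l * C) * E \<le> E0"
    by (simp add: left_diff_distrib)
  then have "h * ((1 - \<bar>ub\<bar> * l * C) * E) \<le> h * E0"
    by (rule mult_left_mono[OF _ less_imp_le[OF h]])
  then have "(1 - \<bar>ub\<bar> * l * C) * (h * E) \<le> h * E0"
    by (simp only: mult.left_commute[of h])
  moreover have "modulated_energy \<epsilon> N \<rho> u \<phi> ub \<phi>b = h * E"
    by (simp add: modulated_energy_eq E_def Kin_def e_def D_def Ent_def)
  moreover have "modulated_energy \<epsilon> N \<rho>0 u0 \<phi>0 ub \<phi>b = h * E0"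
    by (simp add: modulated_energy_eq E0_def Kin0_def e_def D0_def Ent0_def)
  ultimately show ?thesis
    by (simp only: C_def l_def)
qed

end

section \<open>Iteration over the time levels\<close>

lemma scheme_solution_imp_implicit_step:
  assumes "\<exists>L. L-lipschitz_on UNIV g" "g differentiable (at 0)" "\<forall>v. g v \<ge> max v 0"
    and "\<epsilon> > 0" "T > 0" "scheme_solution g \<epsilon> T N\<^sub>T N \<rho> u \<phi>"
    and "\<forall>n\<in>{0..N\<^sub>T}. \<forall>x. \<rho> n x > 0" "discrete_poisson \<epsilon> N (\<rho> 0) (\<phi> 0)"
    and n: "n < N\<^sub>T"
  shows "implicit_step g (Lip g) \<epsilon> (T / real N\<^sub>T) N
    (\<rho> (Suc n)) (u (Suc n)) (\<phi> (Suc n)) (\<rho> n) (u n) (\<phi> n)"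
proof -
  \<comment> \<open>Level 0 is the assumption on the initial data; later levels are part of the
    scheme.\<close>
  have poisson: "discrete_poisson \<epsilon> N (\<rho> k) (\<phi> k)" if "k \<le> N\<^sub>T" for k
    using assms(6,8) that by (cases k) (auto simp: scheme_solution_def)
  have X: "torus_fun (\<rho> k)" "torus_fun (u k)" "torus_fun (\<phi> k)" if "k \<le> N\<^sub>T" for k
    using assms(6) that by (simp_all add: scheme_solution_def X_primal_def X_dual_def)
  have "n \<in> {0..<N\<^sub>T}"
    using n by simp
  with assms(6) have eqs:
    "\<forall>i\<in>{0..int N}.
       (val N (\<rho> (Suc n)) i - val N (\<rho> n) i) / (T / real N\<^sub>T)
       + (flux_half g N (\<rho> (Suc n)) (u (Suc n)) i
          - flux_half g N (\<rho> (Suc n)) (u (Suc n)) (i - 1)) / mesh N = 0"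
    "\<forall>i\<in>{0..int N}.
       (mean_half N (\<rho> (Suc n)) i * val_half N (u (Suc n)) i
        - mean_half N (\<rho> n) i * val_half N (u n) i) / (T / real N\<^sub>T)
       + (flux g N (\<rho> (Suc n)) (u (Suc n)) (i + 1) * upwind g N (\<rho> (Suc n)) (u (Suc n)) (i + 1)
          - flux g N (\<rho> (Suc n)) (u (Suc n)) i * upwind g N (\<rho> (Suc n)) (u (Suc n)) i) / mesh N
       = rho_tilde g N (\<rho> (Suc n)) (u (Suc n)) i * dgrad N (\<phi> (Suc n)) i"
    unfolding scheme_solution_def Suc_eq_plus1 by blast+
  have pos: "\<rho> (Suc n) x > 0" "\<rho> n x > 0" for x
    using assms(7) n by auto
  have tau: "T / real N\<^sub>T > 0" and le: "Suc n \<le> N\<^sub>T" "n \<le> N\<^sub>T"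
    using n assms(5) by auto
  show ?thesis
    by (rule implicit_step.intro)
      (rule X poisson eqs pos tau le assms(2-4) lipschitz_on_Lip[OF assms(1)])+
qed

theorem theorem5:
  fixes g :: "real \<Rightarrow> real" and K\<^sub>0 C\<^sub>0 :: real
    and \<epsilon> T :: real and N\<^sub>T N :: nat
    and \<rho> u \<phi> :: "nat \<Rightarrow> real \<Rightarrow> real"
    and ub \<phi>b :: real
  assumes g_lipschitz: "\<exists>L. L-lipschitz_on UNIV g"
    and g_diff: "g differentiable (at 0)"
    and g_ge: "\<forall>v. g v \<ge> max v 0"
    and eps_pos: "\<epsilon> > 0" and T_pos: "T > 0"
    and NT_pos: "N\<^sub>T > 0" and N_pos: "N > 0"
    and sol: "scheme_solution g \<epsilon> T N\<^sub>T N \<rho> u \<phi>"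
    and rho_pos: "\<forall>n\<in>{0..N\<^sub>T}. \<forall>x. \<rho> n x > 0"
    and init: "discrete_poisson \<epsilon> N (\<rho> 0) (\<phi> 0)"
  shows "(ub = 0 \<longrightarrow>
            (\<forall>n\<in>{0..N\<^sub>T}. modulated_energy \<epsilon> N (\<rho> n) (u n) (\<phi> n) 0 \<phi>b
                          \<le> modulated_energy \<epsilon> N (\<rho> 0) (u 0) (\<phi> 0) 0 \<phi>b))
       \<and> (\<forall>K\<ge>0.
            ub \<noteq> 0 \<and> \<bar>ub\<bar> \<le> g 0 / Lip g
            \<and> K \<le> K\<^sub>0 \<and> (\<forall>n\<in>{0..N\<^sub>T}. Linf_norm (\<rho> n) \<le> ereal K)
            \<and> mesh N \<le> C\<^sub>0 * \<epsilon>
            \<and> cfl_number g \<epsilon> T N\<^sub>T N K ub < 1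
            \<longrightarrow> (\<forall>n\<in>{0..N\<^sub>T}. modulated_energy \<epsilon> N (\<rho> n) (u n) (\<phi> n) ub \<phi>b
                   \<le> (1 / (1 - cfl_number g \<epsilon> T N\<^sub>T N K ub)) ^ n
                      * modulated_energy \<epsilon> N (\<rho> 0) (u 0) (\<phi> 0) ub \<phi>b))"
proof -
  define L where "L = Lip g"
  note step = scheme_solution_imp_implicit_step[OF g_lipschitz g_diff g_ge eps_pos T_pos sol rho_pos init]
  have L: "L \<ge> 1"
    unfolding L_def by (rule lipschitz_ge_one[OF lipschitz_on_Lip[OF g_lipschitz] g_ge])
  have X: "\<rho> n \<in> X_primal N" if "n \<le> N\<^sub>T" for n
    using sol that by (auto simp: scheme_solution_def)
  have bound: "val N (\<rho> n) i \<le> K" if "\<forall>i\<in>{0..int N}. val N (\<rho> n) i \<le> K" "n \<le> N\<^sub>T" for n i K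
  proof (rule periodic_ball_imp_all[OF _ that(1)])
    show "periodic N (\<lambda>i. val N (\<rho> n) i \<le> K)"
      using X[OF that(2)] by (intro periodic_arith periodic_val) (auto simp: X_primal_def)
  qed
  have a: "modulated_energy \<epsilon> N (\<rho> n) (u n) (\<phi> n) 0 \<phi>b
      \<le> modulated_energy \<epsilon> N (\<rho> 0) (u 0) (\<phi> 0) 0 \<phi>b" if "n \<le> N\<^sub>T" for n
    using that
  proof (induction n)
    case (Suc n)
    \<comment> \<open>At rest no uniform bound is given; the maximum over one period serves, and its
      size is irrelevant because the background velocity multiplies it.\<close>
    define K where "K = Max (val N (\<rho> (Suc n)) ` {0..int N})"
    have "val N (\<rho> (Suc n)) i \<le> K" for i
      by (rule bound) (use Suc.prems in \<open>auto simp: K_def\<close>)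
    then have "modulated_energy \<epsilon> N (\<rho> (Suc n)) (u (Suc n)) (\<phi> (Suc n)) 0 \<phi>b
        \<le> modulated_energy \<epsilon> N (\<rho> n) (u n) (\<phi> n) 0 \<phi>b"
      using implicit_step.modulated_energy_step[OF step, of n K 0 \<phi>b] Suc.prems
        g_ge[rule_format, of 0] by simp
    then show ?case
      using Suc by simp
  qed simp
  have b: "modulated_energy \<epsilon> N (\<rho> n) (u n) (\<phi> n) ub \<phi>b
      \<le> (1 / (1 - cfl_number g \<epsilon> T N\<^sub>T N K ub)) ^ n * modulated_energy \<epsilon> N (\<rho> 0) (u 0) (\<phi> 0) ub \<phi>b"
    if ub: "\<bar>ub\<bar> \<le> g 0 / Lip g" and K: "\<forall>n\<in>{0..N\<^sub>T}. Linf_norm (\<rho> n) \<le> ereal K"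
      and cfl: "cfl_number g \<epsilon> T N\<^sub>T N K ub < 1" and n: "n \<le> N\<^sub>T" for K n
    using n
  proof (induction n)
    case (Suc n)
    define c where "c = 1 - cfl_number g \<epsilon> T N\<^sub>T N K ub"
    \<comment> \<open>By the CFL condition; dividing the one-step inequality by \<open>c\<close>
      yields one factor \<open>1 / c\<close> per step.\<close>
    have c: "c > 0"
      using cfl by (simp add: c_def)
    have ubL: "\<bar>ub\<bar> * Lip g \<le> g 0"
      using ub L by (simp add: L_def field_simps)
    have rK: "val N (\<rho> (Suc n)) i \<le> K" for i
      by (rule bound) (use Suc.prems X[OF Suc.prems] K in \<open>auto intro!: val_le_Linf_norm\<close>)
    have "c * modulated_energy \<epsilon> N (\<rho> (Suc n)) (u (Suc n)) (\<phi> (Suc n)) ub \<phi>b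
        \<le> modulated_energy \<epsilon> N (\<rho> n) (u n) (\<phi> n) ub \<phi>b"
      using implicit_step.modulated_energy_step[OF step rK ubL, of \<phi>b] Suc.prems
      by (simp add: c_def cfl_number_def)
    also have "\<dots> \<le> (1 / c) ^ n * modulated_energy \<epsilon> N (\<rho> 0) (u 0) (\<phi> 0) ub \<phi>b"
      using Suc by (simp add: c_def)
    finally have "modulated_energy \<epsilon> N (\<rho> (Suc n)) (u (Suc n)) (\<phi> (Suc n)) ub \<phi>b
        \<le> (1 / c) ^ Suc n * modulated_energy \<epsilon> N (\<rho> 0) (u 0) (\<phi> 0) ub \<phi>b"
      using c by (simp add: field_simps)
    then show ?case
      by (simp add: c_def)
  qed simp
  show ?thesis
  proof (intro conjI impI allI ballI)
    fix n assume "n \<in> {0..N\<^sub>T}"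
    then show "modulated_energy \<epsilon> N (\<rho> n) (u n) (\<phi> n) 0 \<phi>b
        \<le> modulated_energy \<epsilon> N (\<rho> 0) (u 0) (\<phi> 0) 0 \<phi>b"
      by (intro a) simp
  next
    fix K n
    assume "ub \<noteq> 0 \<and> \<bar>ub\<bar> \<le> g 0 / Lip g
        \<and> K \<le> K\<^sub>0 \<and> (\<forall>n\<in>{0..N\<^sub>T}. Linf_norm (\<rho> n) \<le> ereal K)
        \<and> mesh N \<le> C\<^sub>0 * \<epsilon> \<and> cfl_number g \<epsilon> T N\<^sub>T N K ub < 1"
      and "n \<in> {0..N\<^sub>T}"
    then show "modulated_energy \<epsilon> N (\<rho> n) (u n) (\<phi> n) ub \<phi>b
        \<le> (1 / (1 - cfl_number g \<epsilon> T N\<^sub>T N K ub)) ^ n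
          * modulated_energy \<epsilon> N (\<rho> 0) (u 0) (\<phi> 0) ub \<phi>b"
      by (intro b) simp_all
  qed
qed

end
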